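(* Let $\mathcal{Z}=\{z_1,\ldots,z_s\}\subset\mathbb{C}$ be any set of points with $|z_i-z_j|\ge 1$ for all $i\ne j$, let $w_1,\ldots,w_s$ be complex numbers with $|w_i|\le 1$, and let $n\in\mathbb{N}$, $n\ge 1$. Then there is a complex polynomial $P\in\mathcal{P}_{ns-1}^{\mathbb{C}}$ such that for every $\delta$ with $0\le\delta<1/2$ we have $$\max_{i=1,\ldots,s}\ \max_{z\in\mathbb{C}:\,|z-z_i|\le\delta}|P(z)-w_i|\le 2(s-1)\,(A(\mathcal{Z})\,\delta)^n,$$ where $A(\mathcal{Z}):=2(1+2\operatorname{diam}\mathcal{Z})^{s-1}$. If all $w_i,z_i\in\mathbb{R}$, then the polynomial $P$ is in fact from $\mathcal{P}_{ns-1}$, i.e. has real coefficients.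
   Context: $\mathcal{P}_N^{\mathbb{C}}$ denotes the set of polynomials with complex coefficients of degree at most $N$, and $\mathcal{P}_N$ the set of polynomials with real coefficients of degree at most $N$. $\operatorname{diam}\mathcal{Z}=\max_{i,j}|z_i-z_j|$. *)

theory Defs
  imports "HOL-Analysis.Analysis" "HOL-Computational_Algebra.Polynomial"
begin

definition polys_upto :: "nat \<Rightarrow> 'a::zero poly set" where
  "polys_upto N = {p. degree p \<le> N}"

(* For finite nonempty Z the library's diameter, a supremum of distances, is
   the maximum of the pairwise distances. *)
definition A_const :: "complex set \<Rightarrow> real" where
  "A_const Z = 2 * (1 + 2 * diameter Z) ^ (card Z - 1)"

end

theory Submission
  imports Defs "HOL-Computational_Algebra.Polynomial_FPS"
begin

text \<open>
  \<open>P\<close> is the Hermite interpolant: the polynomial of degree \<open>< n s\<close> with \<open>P \<equiv> w\<^sub>i\<close> modulo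
  \<open>(x - z\<^sub>i)\<^sup>n\<close> for all \<open>i\<close>. Its basis polynomials are \<open>H\<^sub>a(x) = L\<^sub>a(x)\<^sup>n T\<^sub>a(x - a)\<close>, where \<open>L\<^sub>a\<close> is
  the Lagrange basis polynomial and \<open>T\<^sub>a\<close> is the power series of \<open>L\<^sub>a(a + u)\<close> to the power
  \<open>-n\<close>, cut off at order \<open>n\<close>. Since the points are 1-separated, this series is dominated
  coefficientwise by that of \<open>1 / (1 - u)\<close> to the power \<open>n (s - 1)\<close>, which bounds \<open>T\<^sub>a\<close>; on the
  disc around another point \<open>b\<close> the factor \<open>x - b\<close> of \<open>L\<^sub>a\<close> contributes \<open>\<delta>\<^sup>n\<close>. By uniqueness the
  \<open>H\<^sub>a\<close> sum to 1, so \<open>P - w\<^sub>b\<close> is the sum of \<open>(w\<^sub>a - w\<^sub>b) H\<^sub>a\<close> over \<open>a \<noteq> b\<close>. For real data the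
  discs are invariant under conjugation, so taking real parts of the coefficients of \<open>P\<close>
  preserves the estimate.
\<close>

lemma poly_eq_sum_atMost:
  fixes p :: "'a::comm_semiring_1 poly"
  assumes "degree p \<le> k"
  shows "poly p x = (\<Sum>i\<le>k. coeff p i * x ^ i)"
  unfolding poly_altdef using assms
  by (intro sum.mono_neutral_left) (auto simp: coeff_eq_0)

section \<open>Domination of power series\<close>

unbundle no vec_syntax and fps_syntax

text \<open>Cauchy's majorant relation. It forces the coefficients of \<open>G\<close> to be
  nonnegative, which makes it compatible with products.\<close>

definition fps_dominated :: "'a::real_normed_algebra_1 fps \<Rightarrow> real fps \<Rightarrow> bool" where
  "fps_dominated F G \<longleftrightarrow> (\<forall>m. norm (F $ m) \<le> G $ m)"

lemma fps_dominated_one: "fps_dominated 1 1"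
  by (simp add: fps_dominated_def)

lemma fps_dominated_mult:
  assumes "fps_dominated F F'" "fps_dominated G G'"
  shows "fps_dominated (F * G) (F' * G')"
  unfolding fps_dominated_def
proof
  fix m
  have "norm ((F * G) $ m) \<le> (\<Sum>i=0..m. norm (F $ i * G $ (m - i)))"
    by (simp add: fps_mult_nth norm_sum)
  also have "\<dots> \<le> (\<Sum>i=0..m. F' $ i * G' $ (m - i))"
  proof (rule sum_mono)
    fix i
    have F: "norm (F $ i) \<le> F' $ i" and G: "norm (G $ (m - i)) \<le> G' $ (m - i)"
      using assms by (auto simp: fps_dominated_def)
    have "norm (F $ i * G $ (m - i)) \<le> norm (F $ i) * norm (G $ (m - i))"
      by (rule norm_mult_ineq)
    also have "\<dots> \<le> F' $ i * G' $ (m - i)"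
      using F G by (intro mult_mono) (auto intro: order_trans[OF norm_ge_zero])
    finally show "norm (F $ i * G $ (m - i)) \<le> F' $ i * G' $ (m - i)" .
  qed
  finally show "norm ((F * G) $ m) \<le> (F' * G') $ m"
    by (simp add: fps_mult_nth)
qed

lemma fps_dominated_power:
  "fps_dominated F G \<Longrightarrow> fps_dominated (F ^ n) (G ^ n)"
  by (induction n) (auto intro: fps_dominated_one fps_dominated_mult)

lemma fps_dominated_prod:
  fixes F :: "'b \<Rightarrow> 'a::{real_normed_algebra_1,comm_ring_1} fps"
  assumes "\<And>k. k \<in> K \<Longrightarrow> fps_dominated (F k) G"
  shows "fps_dominated (\<Prod>k\<in>K. F k) (G ^ card K)"
  using assms
  by (induction K rule: infinite_finite_induct)
     (auto intro: fps_dominated_one fps_dominated_mult)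

text \<open>The expansion of \<open>1 / (1 - c * u)\<close> in \<open>u\<close>, given by its
  coefficients so that domination can be read off termwise.\<close>

definition geometric_fps :: "'a::monoid_mult \<Rightarrow> 'a fps" where
  "geometric_fps c = Abs_fps (\<lambda>m. c ^ m)"

lemma geometric_fps_inverse:
  "fps_of_poly [:1, - c:] * geometric_fps c = (1 :: 'a::field fps)"
proof (rule fps_ext)
  fix m
  show "(fps_of_poly [:1, - c:] * geometric_fps c) $ m = (1 :: 'a fps) $ m"
    by (cases m) (simp_all add: fps_of_poly_linear' geometric_fps_def algebra_simps
        flip: fps_const_neg)
qed

lemma fps_dominated_geometric_fps:
  fixes c :: "'a::real_normed_div_algebra"
  shows "norm c \<le> 1 \<Longrightarrow> fps_dominated (geometric_fps c) (geometric_fps 1)"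
  by (simp add: fps_dominated_def geometric_fps_def norm_power power_le_one)

text \<open>Turns sums of coefficients into single coefficients: it drives the induction below and
  evaluates the coefficient sum of a truncated series.\<close>

lemma geometric_fps_one_mult_nth:
  "(geometric_fps 1 * F) $ m = (\<Sum>i\<le>m. (F :: real fps) $ i)"
  by (subst mult.commute) (simp add: fps_mult_nth geometric_fps_def atLeast0AtMost)

text \<open>The coefficient is the binomial \<open>N + m\<close> choose \<open>m\<close>; summing
  the bounds of the previous power as a geometric series avoids binomials.\<close>

lemma geometric_fps_one_power_nth_le:
  "(geometric_fps 1 ^ Suc N :: real fps) $ m \<le> 2 ^ (N + m)"
proof (induction N arbitrary: m)
  case 0
  show ?case by (simp add: geometric_fps_def)
next
  case (Suc N)
  have "(geometric_fps 1 ^ Suc (Suc N) :: real fps) $ m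
      = (\<Sum>i\<le>m. (geometric_fps 1 ^ Suc N :: real fps) $ i)"
    by (simp only: power_Suc[of _ "Suc N"] geometric_fps_one_mult_nth)
  also have "\<dots> \<le> (\<Sum>i\<le>m. 2 ^ (N + i))"
    by (intro sum_mono Suc.IH)
  also have "\<dots> = 2 ^ N * (\<Sum>i<Suc m. 2 ^ i)"
    by (simp only: power_add sum_distrib_left lessThan_Suc_atMost)
  also have "\<dots> = 2 ^ N * (2 ^ Suc m - 1)"
    using geometric_sum[of "2::real" "Suc m"] by (simp del: sum.lessThan_Suc)
  also have "\<dots> \<le> 2 ^ N * 2 ^ Suc m"
    by (intro mult_left_mono) auto
  also have "\<dots> = 2 ^ (Suc N + m)"
    by (simp add: power_add)
  finally show ?case .
qed

text \<open>As \<open>R\<close> is at least 1, every power of \<open>u\<close> that occurs is at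
  most \<open>R ^ n\<close>. The sum of the first \<open>n\<close> majorant coefficients is
  coefficient \<open>n - 1\<close> of the next power of the geometric series.\<close>

lemma norm_poly_truncate_fps_le:
  fixes G :: "'a::{real_normed_div_algebra,comm_ring_1} fps"
  assumes dom: "fps_dominated G (geometric_fps 1 ^ N)"
    and "n \<ge> 1" and R: "norm u \<le> R" "1 \<le> R"
  shows "norm (poly (truncate_fps n G) u) \<le> R ^ n * 2 ^ (N + n)"
proof -
  obtain k where n: "n = Suc k" using \<open>n \<ge> 1\<close> by (cases n) auto
  have deg: "degree (truncate_fps n G) \<le> k"
    using degree_truncate_fps[of n G] n by simp
  have "poly (truncate_fps n G) u = (\<Sum>i\<le>k. G $ i * u ^ i)"
    using poly_eq_sum_atMost[OF deg, of u] n by (simp add: coeff_truncate_fps)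
  also have "norm \<dots> \<le> (\<Sum>i\<le>k. norm (G $ i * u ^ i))"
    by (rule norm_sum)
  also have "\<dots> \<le> (\<Sum>i\<le>k. (geometric_fps 1 ^ N :: real fps) $ i * R ^ n)"
  proof (rule sum_mono)
    fix i assume "i \<in> {..k}"
    then have "norm u ^ i \<le> R ^ n"
      using R n power_mono[of "norm u" R i] power_increasing[of i n R] by auto
    moreover have "norm (G $ i) \<le> (geometric_fps 1 ^ N :: real fps) $ i"
      using dom by (simp add: fps_dominated_def)
    ultimately show "norm (G $ i * u ^ i) \<le> (geometric_fps 1 ^ N :: real fps) $ i * R ^ n"
      unfolding norm_mult norm_power
      by (intro mult_mono) (auto intro: order_trans[OF norm_ge_zero[of "G $ i"]])
  qed
  also have "\<dots> = (geometric_fps 1 ^ Suc N :: real fps) $ k * R ^ n"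
    by (simp only: power_Suc geometric_fps_one_mult_nth sum_distrib_right)
  also have "\<dots> \<le> 2 ^ (N + k) * R ^ n"
    using R by (intro mult_right_mono geometric_fps_one_power_nth_le) auto
  \<comment> \<open>A factor 2 is given away: for \<open>N\<close> a multiple of \<open>n\<close>,
    the whole bound is then an \<open>n\<close>-th power.\<close>
  also have "\<dots> \<le> R ^ n * 2 ^ (N + n)"
    using R n by (simp add: power_increasing)
  finally show ?thesis .
qed

lemma pcompose_power: "pcompose (p ^ n) r = pcompose p r ^ n"
  by (induction n) (simp_all add: pcompose_1 pcompose_mult)

section \<open>Hermite basis polynomials\<close>

lemma ex_truncated_inverse_poly:
  fixes c :: "'b \<Rightarrow> 'a::real_normed_field"
  assumes "finite K" and c: "\<And>k. k \<in> K \<Longrightarrow> norm (c k) \<le> 1" and "n \<ge> 1"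
  obtains T where "degree T < n"
    and "[:0, 1:] ^ n dvd (\<Prod>k\<in>K. [:1, - c k:]) ^ n * T - 1"
    and "\<And>u R. norm u \<le> R \<Longrightarrow> 1 \<le> R \<Longrightarrow> norm (poly T u) \<le> R ^ n * 2 ^ (n * Suc (card K))"
proof
  define F where "F = (\<Prod>k\<in>K. [:1, - c k:]) ^ n"
  define G where "G = (\<Prod>k\<in>K. geometric_fps (c k)) ^ n"
  define T where "T = truncate_fps n G"
  have FG: "fps_of_poly F * G = 1"
    by (simp only: F_def G_def fps_of_poly_power fps_of_poly_prod geometric_fps_inverse
        prod.neutral_const power_one flip: power_mult_distrib prod.distrib)
  show "degree T < n"
    unfolding T_def using \<open>n \<ge> 1\<close> by (intro degree_truncate_fps) simp
  have "coeff (F * T - 1) m = 0" if "m < n" for m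
  proof -
    \<comment> \<open>Below order \<open>n\<close> the product involves only coefficients of
      \<open>G\<close> that survive truncation, so it agrees with \<open>F * G = 1\<close>.\<close>
    have "coeff (F * T) m = (\<Sum>i\<le>m. coeff F i * G $ (m - i))"
      using that by (auto simp: coeff_mult T_def coeff_truncate_fps intro!: sum.cong)
    also have "\<dots> = (fps_of_poly F * G) $ m"
      by (simp add: fps_mult_nth atLeast0AtMost)
    also have "\<dots> = coeff 1 m"
      by (simp add: FG flip: fps_of_poly_nth)
    finally show ?thesis by simp
  qed
  then have "monom 1 n dvd F * T - 1"
    by (simp add: monom_1_dvd_iff')
  then show "[:0, 1:] ^ n dvd (\<Prod>k\<in>K. [:1, - c k:]) ^ n * T - 1"
    by (simp add: F_def monom_altdef)
  have "fps_dominated G ((geometric_fps 1 ^ card K) ^ n)"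
    unfolding G_def using c
    by (intro fps_dominated_power fps_dominated_prod fps_dominated_geometric_fps)
  then have "fps_dominated G (geometric_fps 1 ^ (n * card K))"
    by (simp add: mult.commute flip: power_mult)
  from norm_poly_truncate_fps_le[OF this \<open>n \<ge> 1\<close>]
  show "norm (poly T u) \<le> R ^ n * 2 ^ (n * Suc (card K))"
    if "norm u \<le> R" "1 \<le> R" for u R
    using that by (simp add: T_def add.commute)
qed

lemma ex_Hermite_basis_poly:
  fixes Z :: "complex set"
  assumes fin: "finite Z" and a: "a \<in> Z" and n: "n \<ge> 1"
    and sep: "\<And>x y. x \<in> Z \<Longrightarrow> y \<in> Z \<Longrightarrow> x \<noteq> y \<Longrightarrow> cmod (x - y) \<ge> 1"
  obtains H where "degree H < n * card Z"
    and "[:- a, 1:] ^ n dvd H - 1"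
    and "\<And>b. b \<in> Z - {a} \<Longrightarrow> [:- b, 1:] ^ n dvd H"
    and "\<And>b x \<delta>. b \<in> Z - {a} \<Longrightarrow> cmod (x - b) \<le> \<delta> \<Longrightarrow> \<delta> < 1 / 2 \<Longrightarrow>
           cmod (poly H x) \<le> (A_const Z * \<delta>) ^ n"
proof -
  define K where "K = Z - {a}"
  have fK: "finite K" and cK: "card Z = Suc (card K)"
    using fin a card_Suc_Diff1[OF fin a] by (auto simp: K_def)
  have aK: "cmod (a - k) \<ge> 1" if "k \<in> K" for k
    using sep[OF a, of k] that by (auto simp: K_def)
  have aK': "a \<noteq> k" if "k \<in> K" for k using that by (auto simp: K_def)
  \<comment> \<open>With \<open>x = a + u\<close>, the Lagrange factor
    \<open>(x - k) / (a - k)\<close> becomes \<open>1 - c k * u\<close>; separation gives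
    \<open>c k\<close> modulus at most 1.\<close>
  define c where "c k = 1 / (k - a)" for k
  have c: "cmod (c k) \<le> 1" if "k \<in> K" for k
    using aK[OF that] by (simp add: c_def norm_divide norm_minus_commute divide_le_eq)
  obtain T where T: "degree T < n" "[:0, 1:] ^ n dvd (\<Prod>k\<in>K. [:1, - c k:]) ^ n * T - 1"
    and Tle: "\<And>u R. norm u \<le> R \<Longrightarrow> 1 \<le> R \<Longrightarrow> cmod (poly T u) \<le> R ^ n * 2 ^ (n * Suc (card K))"
    by (rule ex_truncated_inverse_poly[OF fK c n]) (assumption | rule that | blast)+
  define L where "L k = smult (1 / (a - k)) [:- k, 1:]" for k
  define H where "H = (\<Prod>k\<in>K. L k) ^ n * pcompose T [:- a, 1:]"
  have L: "pcompose [:1, - c k:] [:- a, 1:] = L k" if "k \<in> K" for k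
    using aK'[OF that] by (simp add: L_def c_def pcompose_pCons field_simps)
  show ?thesis
  proof
    have "degree (\<Prod>k\<in>K. L k) \<le> (\<Sum>k\<in>K. degree (L k))"
      using degree_prod_sum_le[OF fK, of L] by (simp add: o_def)
    also have "\<dots> \<le> (\<Sum>k\<in>K. 1)"
      by (intro sum_mono) (simp add: L_def)
    finally have "degree ((\<Prod>k\<in>K. L k) ^ n) \<le> n * card K"
      by (intro order_trans[OF degree_power_le]) simp
    moreover have "degree (pcompose T [:- a, 1:]) < n"
      using T(1) by (simp add: degree_pcompose)
    ultimately have "degree H < n * card K + n"
      unfolding H_def by (intro le_less_trans[OF degree_mult_le]) simp
    then show "degree H < n * card Z" by (simp add: cK add.commute)
  next
    obtain q where q: "(\<Prod>k\<in>K. [:1, - c k:]) ^ n * T - 1 = [:0, 1:] ^ n * q"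
      using T(2) ..
    have "H - 1 = pcompose ((\<Prod>k\<in>K. [:1, - c k:]) ^ n * T - 1) [:- a, 1:]"
      by (simp add: H_def pcompose_diff pcompose_mult pcompose_power pcompose_prod L
          pcompose_1)
    also have "\<dots> = [:- a, 1:] ^ n * pcompose q [:- a, 1:]"
      unfolding q by (simp add: pcompose_mult pcompose_power pcompose_pCons)
    finally show "[:- a, 1:] ^ n dvd H - 1" by simp
  next
    fix b assume "b \<in> Z - {a}"
    then have b: "b \<in> K" by (simp add: K_def)
    have "[:- b, 1:] dvd L b"
      unfolding L_def by (intro dvd_smult) simp
    also have "\<dots> dvd (\<Prod>k\<in>K. L k)"
      using fK b by (rule dvd_prodI)
    finally show "[:- b, 1:] ^ n dvd H"
      unfolding H_def by (intro dvd_mult2 dvd_power_same)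
  next
    fix b x \<delta> assume "b \<in> Z - {a}" and x: "cmod (x - b) \<le> \<delta>" and \<delta>: "\<delta> < 1 / 2"
    then have b: "b \<in> K" "b \<in> Z" by (simp_all add: K_def)
    have \<delta>0: "0 \<le> \<delta>" using x norm_ge_zero order_trans by blast
    \<comment> \<open>Bounds the distance from \<open>x\<close> to every point of \<open>Z\<close>,
      \<open>a\<close> included: at most the diameter from \<open>b\<close>, plus \<delta> < 1/2.
      Twice \<open>R\<close> is the base in \<open>A_const\<close>.\<close>
    define R where "R = diameter Z + 1 / 2"
    have diam: "cmod (y - z) \<le> diameter Z" if "y \<in> Z" "z \<in> Z" for y z
      using diameter_bounded_bound[OF finite_imp_bounded[OF fin] that] by (simp add: dist_norm)
    have R: "1 \<le> R"
      using diam[OF a b(2)] aK[OF b(1)] by (simp add: R_def)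
    have xR: "cmod (x - k) \<le> R" if "k \<in> Z" for k
      using norm_triangle_ineq[of "x - b" "b - k"] x \<delta> diam[OF b(2) that] by (simp add: R_def)
    have Lk: "cmod (poly (L k) x) \<le> cmod (x - k)" if "k \<in> K" for k
    proof -
      have "cmod (poly (L k) x) = cmod (x - k) / cmod (a - k)"
        by (simp add: L_def norm_divide flip: diff_divide_distrib)
      also have "\<dots> \<le> cmod (x - k) / 1"
        using aK[OF that] by (intro divide_left_mono) auto
      finally show ?thesis by simp
    qed
    \<comment> \<open>The factor at \<open>b\<close> supplies \<delta>; each other factor is at most
      \<open>R\<close>, since its denominator has modulus at least 1.\<close>
    have "cmod (poly (\<Prod>k\<in>K. L k) x) = cmod (poly (L b) x) * (\<Prod>k\<in>K - {b}. cmod (poly (L k) x))"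
      using fK b(1) by (simp add: poly_prod prod.remove norm_mult flip: prod_norm)
    also have "\<dots> \<le> \<delta> * (\<Prod>k\<in>K - {b}. R)"
      using Lk b(1) x xR \<delta>0 order_trans[OF Lk xR]
      by (intro mult_mono prod_mono prod_nonneg) (force simp: K_def)+
    also have "\<dots> = \<delta> * R ^ (card K - 1)"
      using fK b by simp
    finally have PL: "cmod (poly (\<Prod>k\<in>K. L k) x) \<le> \<delta> * R ^ (card K - 1)" .
    have "cmod (poly H x) = cmod (poly (\<Prod>k\<in>K. L k) x) ^ n * cmod (poly T (x - a))"
      by (simp add: H_def poly_pcompose norm_mult norm_power)
    also have "\<dots> \<le> (\<delta> * R ^ (card K - 1)) ^ n * (R ^ n * 2 ^ (n * Suc (card K)))"
      using PL Tle[OF xR[OF a] R] \<delta>0 R by (intro mult_mono power_mono) auto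
    \<comment> \<open>The bound on \<open>T\<close> supplies the \<open>R\<close> missing for
      exponent \<open>card K\<close> (positive because of \<open>b\<close>), and one of the
      \<open>card K + 1\<close> factors 2 is left over as the leading 2 of
      \<open>A_const\<close>.\<close>
    also have "\<dots> = (\<delta> * (R ^ (card K - 1) * R) * 2 ^ Suc (card K)) ^ n"
      by (simp only: power_mult_distrib power_mult mult.commute[of n] mult.assoc)
    also have "R ^ (card K - 1) * R = R ^ card K"
      using fK b(1) by (intro power_minus_mult) (auto simp: card_gt_0_iff)
    also have "\<delta> * R ^ card K * 2 ^ Suc (card K) = \<delta> * (2 * (2 * R) ^ card K)"
      by (simp add: power_mult_distrib)
    also have "2 * R = 1 + 2 * diameter Z" by (simp add: R_def)
    finally show "cmod (poly H x) \<le> (A_const Z * \<delta>) ^ n"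
      by (simp add: A_const_def cK mult.commute)
  qed
qed

text \<open>Counts roots with multiplicity, splitting off one point at a time: the degree drops by
  exactly \<open>n\<close>. This is the uniqueness of Hermite interpolation.\<close>

lemma poly_eq_0_if_multiple_roots:
  fixes p :: "'a::field poly"
  assumes "finite Z" "\<And>a. a \<in> Z \<Longrightarrow> [:- a, 1:] ^ n dvd p" "degree p < n * card Z"
  shows "p = 0"
  using assms
proof (induction Z arbitrary: p rule: finite_induct)
  case (insert a Z)
  have "[:- a, 1:] ^ n dvd p" using insert.prems(1) by simp
  then obtain q where q: "p = [:- a, 1:] ^ n * q" ..
  show ?case
  proof (rule ccontr)
    assume "p \<noteq> 0"
    then have "q \<noteq> 0" using q by auto
    have "degree p = n + degree q"
      unfolding q using \<open>q \<noteq> 0\<close> by (subst degree_mult_eq) (auto simp: degree_linear_power)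
    then have "degree q < n * card Z"
      using insert.prems(2) insert.hyps by simp
    moreover have "[:- b, 1:] ^ n dvd q" if "b \<in> Z" for b
    proof -
      \<comment> \<open>Since \<open>b\<close> differs from \<open>a\<close>, the removed factor
        does not vanish at \<open>b\<close>, so \<open>q\<close> keeps the full multiplicity
        there.\<close>
      have "order b ([:- a, 1:] ^ n) = 0"
        using that insert.hyps by (intro order_0I) auto
      then have "order b p = order b q"
        unfolding q using \<open>p \<noteq> 0\<close> q by (subst order_mult) auto
      then show ?thesis
        using insert.prems(1)[of b] that \<open>p \<noteq> 0\<close> by (simp add: order_divides)
    qed
    ultimately show False using insert.IH \<open>q \<noteq> 0\<close> by blast
  qed
qed simp

section \<open>The interpolating polynomial\<close>

lemma ex_Hermite_interpolation:
  fixes Z :: "complex set" and w :: "complex \<Rightarrow> complex"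
  assumes fin: "finite Z" and n: "n \<ge> 1" and ne: "Z \<noteq> {}"
    and sep: "\<And>x y. x \<in> Z \<Longrightarrow> y \<in> Z \<Longrightarrow> x \<noteq> y \<Longrightarrow> cmod (x - y) \<ge> 1"
    and w: "\<And>a. a \<in> Z \<Longrightarrow> cmod (w a) \<le> 1"
  obtains P where "degree P < n * card Z"
    and "\<And>a x \<delta>. a \<in> Z \<Longrightarrow> cmod (x - a) \<le> \<delta> \<Longrightarrow> \<delta> < 1 / 2 \<Longrightarrow>
           cmod (poly P x - w a) \<le> 2 * (real (card Z) - 1) * (A_const Z * \<delta>) ^ n"
proof -
  have "\<forall>a\<in>Z. \<exists>H. degree H < n * card Z \<and> [:- a, 1:] ^ n dvd H - 1 \<and>
      (\<forall>b\<in>Z - {a}. [:- b, 1:] ^ n dvd H) \<and>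
      (\<forall>b\<in>Z - {a}. \<forall>x \<delta>. cmod (x - b) \<le> \<delta> \<longrightarrow> \<delta> < 1 / 2 \<longrightarrow>
         cmod (poly H x) \<le> (A_const Z * \<delta>) ^ n)"
    by (intro ballI, rule ex_Hermite_basis_poly[OF fin _ n sep]) (assumption | blast)+
  from bchoice[OF this] obtain H where deg: "\<And>a. a \<in> Z \<Longrightarrow> degree (H a) < n * card Z"
    and H1: "\<And>a. a \<in> Z \<Longrightarrow> [:- a, 1:] ^ n dvd H a - 1"
    and H0: "\<And>a b. a \<in> Z \<Longrightarrow> b \<in> Z - {a} \<Longrightarrow> [:- b, 1:] ^ n dvd H a"
    and Hle: "\<And>a b x \<delta>. a \<in> Z \<Longrightarrow> b \<in> Z - {a} \<Longrightarrow> cmod (x - b) \<le> \<delta> \<Longrightarrow> \<delta> < 1 / 2 \<Longrightarrow>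
       cmod (poly (H a) x) \<le> (A_const Z * \<delta>) ^ n"
    by blast
  have pos: "0 < n * card Z" using fin ne n by (simp add: card_gt_0_iff)
  \<comment> \<open>Modulo the \<open>n\<close>-th power of \<open>x - b\<close> only
    \<open>H b\<close> survives, and it is 1; the degree is too small for a nonzero
    difference.\<close>
  have "(\<Sum>a\<in>Z. H a) - 1 = 0"
  proof (rule poly_eq_0_if_multiple_roots[OF fin])
    fix b assume b: "b \<in> Z"
    have "(\<Sum>a\<in>Z. H a) - 1 = (H b - 1) + (\<Sum>a\<in>Z - {b}. H a)"
      using fin b by (simp add: sum.remove)
    also have "[:- b, 1:] ^ n dvd \<dots>"
      using b by (intro dvd_add H1 dvd_sum H0) auto
    finally show "[:- b, 1:] ^ n dvd (\<Sum>a\<in>Z. H a) - 1" .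
  next
    show "degree ((\<Sum>a\<in>Z. H a) - 1) < n * card Z"
      using pos deg by (intro degree_diff_less degree_sum_less) auto
  qed
  then have sum1: "(\<Sum>a\<in>Z. H a) = 1" by simp
  define P where "P = (\<Sum>a\<in>Z. smult (w a) (H a))"
  show ?thesis
  proof
    show "degree P < n * card Z"
      unfolding P_def using pos deg
      by (intro degree_sum_less) (auto intro: le_less_trans[OF degree_smult_le])
  next
    fix b x \<delta> assume b: "b \<in> Z" and x: "cmod (x - b) \<le> \<delta>" "\<delta> < 1 / 2"
    have "poly (\<Sum>a\<in>Z. H a) x = 1" by (simp add: sum1)
    \<comment> \<open>Expanding the constant \<open>w b\<close> in the same basis cancels the term
      at \<open>b\<close>. This leaves \<open>card Z - 1\<close> terms with coefficients of modulus
      at most 2.\<close>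
    then have "w b = (\<Sum>a\<in>Z. w b * poly (H a) x)"
      by (simp add: poly_sum flip: sum_distrib_left)
    then have "poly P x - w b = (\<Sum>a\<in>Z. (w a - w b) * poly (H a) x)"
      by (simp add: P_def poly_sum left_diff_distrib sum_subtractf)
    also have "\<dots> = (\<Sum>a\<in>Z - {b}. (w a - w b) * poly (H a) x)"
      using fin b by (simp add: sum.remove)
    also have "cmod \<dots> \<le> (\<Sum>a\<in>Z - {b}. 2 * (A_const Z * \<delta>) ^ n)"
    proof (rule sum_norm_le)
      fix a assume a: "a \<in> Z - {b}"
      then have "cmod (w a - w b) \<le> 2"
        using w[of a] w[OF b] norm_triangle_ineq4[of "w a" "w b"] by auto
      moreover have "cmod (poly (H a) x) \<le> (A_const Z * \<delta>) ^ n"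
        using a b x by (intro Hle) auto
      ultimately show "cmod ((w a - w b) * poly (H a) x) \<le> 2 * (A_const Z * \<delta>) ^ n"
        by (simp add: norm_mult mult_mono)
    qed
    also have "\<dots> = 2 * (real (card Z) - 1) * (A_const Z * \<delta>) ^ n"
      using fin b pos by (simp add: of_nat_diff Suc_le_eq)
    finally show "cmod (poly P x - w b) \<le> 2 * (real (card Z) - 1) * (A_const Z * \<delta>) ^ n" .
  qed
qed

text \<open>Conjugating the coefficients of \<open>P\<close> gives the function
  \<open>cnj (poly P (cnj x))\<close>; taking real parts averages it with \<open>P\<close>.\<close>

lemma poly_map_poly_Re:
  "poly (map_poly complex_of_real (map_poly Re P)) x = (poly P x + cnj (poly P (cnj x))) / 2"
proof -
  have Re: "complex_of_real (Re c) = (c + cnj c) / 2" for c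
    by (simp add: complex_add_cnj)
  have "poly (map_poly complex_of_real (map_poly Re P)) x
      = (\<Sum>i\<le>degree P. complex_of_real (Re (coeff P i)) * x ^ i)"
    \<comment> \<open>Taking real parts may lower the degree, so the sum is taken up to
      \<open>degree P\<close>.\<close>
    by (subst poly_eq_sum_atMost[of _ "degree P"])
       (auto simp: coeff_map_poly intro!: order_trans[OF map_poly_degree_leq] map_poly_degree_leq)
  also have "\<dots> = (poly P x + cnj (poly P (cnj x))) / 2"
    by (simp add: Re poly_altdef sum_divide_distrib add_divide_distrib distrib_right
        flip: sum.distrib)
  finally show ?thesis .
qed

theorem theorem2:
  fixes s n :: nat and z w :: "nat \<Rightarrow> complex"
  assumes "s \<ge> 1" and "n \<ge> 1"
    and "\<And>i j. i \<in> {1..s} \<Longrightarrow> j \<in> {1..s} \<Longrightarrow> i \<noteq> j \<Longrightarrow> cmod (z i - z j) \<ge> 1"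
    and "\<And>i. i \<in> {1..s} \<Longrightarrow> cmod (w i) \<le> 1"
  shows "\<exists>P \<in> (polys_upto (n * s - 1) :: complex poly set).
      (\<forall>\<delta>::real. 0 \<le> \<delta> \<and> \<delta> < 1 / 2 \<longrightarrow>
        (\<forall>i\<in>{1..s}. \<forall>x::complex. cmod (x - z i) \<le> \<delta> \<longrightarrow>
          cmod (poly P x - w i) \<le> 2 * (real s - 1) * (A_const (z ` {1..s}) * \<delta>) ^ n)) \<and>
      ((\<forall>i\<in>{1..s}. w i \<in> \<real> \<and> z i \<in> \<real>) \<longrightarrow>
        P \<in> map_poly complex_of_real ` (polys_upto (n * s - 1) :: real poly set))"
proof -
  define Z where "Z = z ` {1..s}"
  have inj: "inj_on z {1..s}"
  proof (rule inj_onI, rule ccontr)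
    fix i j assume "i \<in> {1..s}" "j \<in> {1..s}" "z i = z j" "i \<noteq> j"
    with assms(3)[of i j] show False by simp
  qed
  \<comment> \<open>Reindexes the values by the points themselves, using that separation makes
    \<open>z\<close> injective.\<close>
  define v where "v a = w (the_inv_into {1..s} z a)" for a
  have v: "v (z i) = w i" if "i \<in> {1..s}" for i
    using the_inv_into_f_f[OF inj that] by (simp add: v_def)
  have card: "card Z = s"
    using card_image[OF inj] by (simp add: Z_def)
  have sep: "cmod (x - y) \<ge> 1" if "x \<in> Z" "y \<in> Z" "x \<noteq> y" for x y
  proof -
    obtain i j where "i \<in> {1..s}" "j \<in> {1..s}" "x = z i" "y = z j"
      using \<open>x \<in> Z\<close> \<open>y \<in> Z\<close> by (auto simp: Z_def)
    then show ?thesis using assms(3)[of i j] \<open>x \<noteq> y\<close> by auto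
  qed
  have vle: "cmod (v a) \<le> 1" if "a \<in> Z" for a
    using that v assms(4) by (auto simp: Z_def)
  have Z: "finite Z" "Z \<noteq> {}" using assms(1) by (auto simp: Z_def)
  obtain P where "degree P < n * card Z"
    and P0: "\<And>a x \<delta>. a \<in> Z \<Longrightarrow> cmod (x - a) \<le> \<delta> \<Longrightarrow> \<delta> < 1 / 2 \<Longrightarrow>
           cmod (poly P x - v a) \<le> 2 * (real (card Z) - 1) * (A_const Z * \<delta>) ^ n"
    by (rule ex_Hermite_interpolation[OF Z(1) assms(2) Z(2) sep vle])
       (assumption | rule that | blast)+
  then have deg: "degree P \<le> n * s - 1" by (simp add: card)
  have P: "cmod (poly P x - w i) \<le> 2 * (real s - 1) * (A_const Z * \<delta>) ^ n"
    if "i \<in> {1..s}" "cmod (x - z i) \<le> \<delta>" "\<delta> < 1 / 2" for i x \<delta>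
  proof -
    have "z i \<in> Z" using that(1) by (simp add: Z_def)
    from P0[OF this that(2,3)] show ?thesis using v[OF that(1)] by (simp add: card)
  qed
  show ?thesis
  \<comment> \<open>The witness depends on the data: \<open>P\<close> itself if some datum is not
    real, otherwise its coefficientwise real part.\<close>
  proof (cases "\<forall>i\<in>{1..s}. w i \<in> \<real> \<and> z i \<in> \<real>")
    case False
    then show ?thesis
      using deg P by (intro bexI[of _ P]) (auto simp: polys_upto_def Z_def)
  next
    case True
    define Q where "Q = map_poly Re P"
    have degQ: "degree Q \<le> n * s - 1"
      unfolding Q_def using map_poly_degree_leq deg by (rule order_trans)
    have "cmod (poly (map_poly complex_of_real Q) x - w i)
        \<le> 2 * (real s - 1) * (A_const Z * \<delta>) ^ n" (is "_ \<le> ?B")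
      if i: "i \<in> {1..s}" and x: "cmod (x - z i) \<le> \<delta>" "\<delta> < 1 / 2" for i x \<delta>
    proof -
      have real: "cnj (w i) = w i" "cnj (z i) = z i"
        using True i by (auto simp: Reals_cnj_iff)
      \<comment> \<open>A disc with real centre is closed under conjugation, so the estimate for
        \<open>P\<close> also applies at \<open>cnj x\<close>.\<close>
      have "cmod (cnj x - z i) = cmod (cnj (x - z i))"
        by (simp add: real)
      then have "cmod (poly P (cnj x) - w i) \<le> ?B"
        using x by (intro P[OF i]) (simp_all only: complex_mod_cnj)
      moreover have "cmod (cnj (poly P (cnj x)) - w i) = cmod (cnj (poly P (cnj x) - w i))"
        by (simp add: real)
      ultimately have cnj_le: "cmod (cnj (poly P (cnj x)) - w i) \<le> ?B"
        by (simp only: complex_mod_cnj)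
      \<comment> \<open>The error of \<open>Q\<close> is the mean of two errors that are each at
        most \<open>?B\<close>, so no constant is lost.\<close>
      have "poly (map_poly complex_of_real Q) x - w i
          = ((poly P x - w i) + (cnj (poly P (cnj x)) - w i)) / 2"
        by (simp add: Q_def poly_map_poly_Re field_simps)
      also have "cmod \<dots> \<le> (?B + ?B) / 2"
        unfolding norm_divide using cnj_le P[OF i x]
        by (intro divide_mono norm_triangle_mono) auto
      also have "\<dots> = ?B" by (rule field_sum_of_halves[of ?B, folded add_divide_distrib])
      finally show ?thesis .
    qed
    moreover have "degree (map_poly complex_of_real Q) \<le> n * s - 1"
      using map_poly_degree_leq degQ by (rule order_trans)
    ultimately show ?thesis
      using degQ by (intro bexI[of _ "map_poly complex_of_real Q"]) (auto simp: polys_upto_def Z_def)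
  qed
qed

end
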